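(* Let $f,d\in V^*$, $y\in\mathbf Q(f)$, let $\Phi$ be Hadamard directionally differentiable at $y$, and set $\mathcal K^y:=\mathcal T_{\mathbf K(y)}(y)\cap[f-Ay]^\perp$ and $\mathcal K^y(w):=\Phi'(y)(w)+\mathcal K^y$. Let $\alpha\in V$. Then $$\alpha\in\mathcal K^y(\alpha):\quad\langle A\alpha-d,\,\alpha-v\rangle\le0\quad\forall v\in\mathcal K^y(\alpha)$$ holds if and only if, with $\xi_d:=d-A\alpha$, $$\alpha-\Phi'(y)(\alpha)\in\mathcal K^y,\qquad \xi_d\in(\mathcal K^y)^\circ,\qquad\langle\xi_d,\Phi'(y)(\alpha)-\alpha\rangle=0 .$$
   Context: $V$ is a real reflexive Banach space which is a vector lattice for the order $u\le v\iff v-u\in V_+$ induced by a closed convex cone $V_+$ with $V_+\cap(-V_+)=\{0\}$, and $v_n\to v$ in $V$ implies $\sup(0,v_n)\rightharpoonup\sup(0,v)$ in $V$. With $u^+:=\sup(0,u)$, $u^-:=u^+-u$, $A\colon V\to V^*$ is linear and $C_a,C_b>0$ are constants with $\langle Au,v\rangle\le C_b\|u\|_V\|v\|_V$, $\langle Au,u\rangle\ge C_a\|u\|_V^2$, $\langle Au^+,u^-\rangle\le0$ for all $u,v\in V$. $\Phi\colon V\to V$ is a given map. $\mathbf K(w):=\{v\in V:v\le\Phi(w)\}$. $\mathbf Q(f)$ is the set of all $y\in V$ with $y\in\mathbf K(y)$ and $\langle Ay-f,y-v\rangle\le0$ for all $v\in\mathbf K(y)$. $\mathcal T_{\mathbf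 K(y)}(y)$ is the closure in $V$ of the radial cone $\{h\in V:\exists s^*>0,\ y+sh\in\mathbf K(y)\ \forall s\in[0,s^*]\}$. $[g]^\perp:=\{v\in V:\langle g,v\rangle=0\}$. The polar cone of $M\subset V$ is $M^\circ:=\{g\in V^*:\langle g,v\rangle\le0\ \forall v\in M\}$. Hadamard directional differentiability at $y$ means: for every $h\in V$ there is $\Phi'(y)(h)\in V$ with $s^{-1}(\Phi(y+sh_s)-\Phi(y))\to\Phi'(y)(h)$ in $V$ as $s\to0^+$ whenever $h_s\to h$ in $V$. *)

theory Defs
  imports "HOL-Analysis.Analysis"
begin

type_synonym 'v dual = "'v \<Rightarrow>\<^sub>L real"

abbreviation dual_pairing :: "'v::real_normed_vector dual \<Rightarrow> 'v \<Rightarrow> real"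
    ("\<langle>_,/ _\<rangle>") where
  "\<langle>g, v\<rangle> \<equiv> blinfun_apply g v"

text \<open>Surjectivity of the canonical embedding into the bidual; as this embedding is always
  isometric, surjectivity is all that reflexivity requires.\<close>

definition reflexive_space :: "'v::real_normed_vector itself \<Rightarrow> bool" where
  "reflexive_space _ \<longleftrightarrow> (\<forall>\<phi> :: 'v dual dual. \<exists>v::'v. \<forall>g. \<langle>\<phi>, g\<rangle> = \<langle>g, v\<rangle>)"

definition weakly_tendsto :: "(nat \<Rightarrow> 'v::real_normed_vector) \<Rightarrow> 'v \<Rightarrow> bool" where
  "weakly_tendsto x l \<longleftrightarrow> (\<forall>g :: 'v dual. (\<lambda>n. \<langle>g, x n\<rangle>) \<longlonglongrightarrow> \<langle>g, l\<rangle>)"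

definition pos_part :: "'v::{real_vector, lattice} \<Rightarrow> 'v" where
  "pos_part u = sup 0 u"

text \<open>With this sign convention \<open>neg_part u\<close> is nonnegative and
  \<open>u = pos_part u - neg_part u\<close>.\<close>

definition neg_part :: "'v::{real_vector, lattice} \<Rightarrow> 'v" where
  "neg_part u = pos_part u - u"

definition constraint_set :: "('v \<Rightarrow> 'v::order) \<Rightarrow> 'v \<Rightarrow> 'v set" where
  "constraint_set \<Phi> w = {v. v \<le> \<Phi> w}"

definition qvi_solutions ::
    "('v::{real_normed_vector, order} \<Rightarrow> 'v dual) \<Rightarrow> ('v \<Rightarrow> 'v) \<Rightarrow> 'v dual \<Rightarrow> 'v set" where
  "qvi_solutions A \<Phi> f =
     {y. y \<in> constraint_set \<Phi> y \<and> (\<forall>v\<in>constraint_set \<Phi> y. \<langle>A y - f, y - v\<rangle> \<le> 0)}"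

definition radial_cone :: "'v::real_vector set \<Rightarrow> 'v \<Rightarrow> 'v set" where
  "radial_cone C y = {h. \<exists>s'>0. \<forall>s\<in>{0..s'}. y + s *\<^sub>R h \<in> C}"

definition tangent_cone :: "'v::real_normed_vector set \<Rightarrow> 'v \<Rightarrow> 'v set" where
  "tangent_cone C y = closure (radial_cone C y)"

definition annihilator :: "'v::real_normed_vector dual \<Rightarrow> 'v set" where
  "annihilator g = {v. \<langle>g, v\<rangle> = 0}"

definition polar_cone :: "'v::real_normed_vector set \<Rightarrow> 'v dual set" where
  "polar_cone M = {g. \<forall>v\<in>M. \<langle>g, v\<rangle> \<le> 0}"

text \<open>\<open>d\<close> is the Hadamard directional derivative of \<open>\<Phi>\<close> at \<open>y\<close> in direction \<open>h\<close>. Only the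
  behaviour of the family \<open>hs\<close> for small \<open>s > 0\<close> matters. Such a \<open>d\<close> is unique (take \<open>hs\<close>
  constant).\<close>

definition has_hadamard_dderiv ::
    "('v::real_normed_vector \<Rightarrow> 'w::real_normed_vector) \<Rightarrow> 'v \<Rightarrow> 'v \<Rightarrow> 'w \<Rightarrow> bool" where
  "has_hadamard_dderiv \<Phi> y h d \<longleftrightarrow>
     (\<forall>hs :: real \<Rightarrow> 'v. (hs \<longlongrightarrow> h) (at_right 0) \<longrightarrow>
        ((\<lambda>s. (\<Phi> (y + s *\<^sub>R hs s) - \<Phi> y) /\<^sub>R s) \<longlongrightarrow> d) (at_right 0))"

definition critical_cone ::
    "('v::{real_normed_vector, order} \<Rightarrow> 'v dual) \<Rightarrow> ('v \<Rightarrow> 'v) \<Rightarrow> 'v dual \<Rightarrow> 'v \<Rightarrow> 'v set" where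
  "critical_cone A \<Phi> f y = tangent_cone (constraint_set \<Phi> y) y \<inter> annihilator (f - A y)"

end

theory Submission
  imports Defs
begin

text \<open>Once \<open>\<alpha>\<close> is fixed, \<open>\<Phi>' \<alpha>\<close> is a fixed
  vector, so the moving set is just a translate of the critical cone \<open>K\<close>. Translating
  back by \<open>\<Phi>' \<alpha>\<close> turns the quasi-variational inequality into a variational
  inequality over \<open>K\<close> for the point \<open>\<alpha> - \<Phi>' \<alpha>\<close>. As
  \<open>K\<close> is a cone through the origin, this is equivalent to a complementarity system by
  \<open>variational_inequality_cone_iff\<close>. The lemmas \<open>cone_critical_cone\<close> and
  \<open>zero_in_critical_cone\<close> supply the two properties of \<open>K\<close>.\<close>

lemma cone_radial_cone: "cone (radial_cone C y)"
  unfolding cone_def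
proof (intro ballI allI impI)
  fix h and c :: real
  assume "h \<in> radial_cone C y" and c: "0 \<le> c"
  then obtain s' where s': "s' > 0" "\<And>s. s \<in> {0..s'} \<Longrightarrow> y + s *\<^sub>R h \<in> C"
    unfolding radial_cone_def by blast
  \<comment> \<open>Dividing by \<open>c + 1\<close> instead of \<open>c\<close> keeps the step
    length positive and well defined at \<open>c = 0\<close>, which \<open>cone\<close>
    includes.\<close>
  have "y + s *\<^sub>R (c *\<^sub>R h) \<in> C" if s: "s \<in> {0..s' / (c + 1)}" for s
  proof -
    have "s * c \<le> s * (c + 1)" using s by (simp add: algebra_simps)
    also have "\<dots> \<le> s'" using s c by (simp add: field_simps)
    finally show ?thesis using s'(2)[of "s * c"] s c by simp
  qed
  moreover have "s' / (c + 1) > 0" using s' c by simp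
  ultimately show "c *\<^sub>R h \<in> radial_cone C y"
    unfolding radial_cone_def by blast
qed

lemma zero_in_radial_cone: "y \<in> C \<Longrightarrow> 0 \<in> radial_cone C y"
  unfolding radial_cone_def by (auto intro: exI[of _ 1])

lemma cone_critical_cone: "cone (critical_cone A \<Phi> f y)"
proof -
  have "cone (tangent_cone (constraint_set \<Phi> y) y)"
    unfolding tangent_cone_def by (intro cone_closure cone_radial_cone)
  then show ?thesis
    by (simp add: critical_cone_def annihilator_def cone_def blinfun.scaleR_right)
qed

text \<open>The predicate \<open>cone\<close> also holds for the empty set, so the origin needs its
  own argument: feasibility of \<open>y\<close> makes the zero direction radial.\<close>

lemma zero_in_critical_cone:
  assumes "y \<in> constraint_set \<Phi> y"
  shows "0 \<in> critical_cone A \<Phi> f y"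
  using subsetD[OF closure_subset zero_in_radial_cone[OF assms]]
  by (simp add: critical_cone_def tangent_cone_def annihilator_def)

text \<open>The points \<open>0\<close> and \<open>2 *\<^sub>R x\<close> of the ray through
  \<open>x\<close> are the only test points needed to force orthogonality; after that the term with
  \<open>x\<close> drops out and the inequality says exactly that \<open>g\<close> is polar to
  \<open>K\<close>.\<close>

lemma variational_inequality_cone_iff:
  assumes "cone K" and "0 \<in> K" and x: "x \<in> K"
  shows "(\<forall>v\<in>K. \<langle>g, v - x\<rangle> \<le> 0) \<longleftrightarrow> g \<in> polar_cone K \<and> \<langle>g, x\<rangle> = 0"
proof
  assume *: "\<forall>v\<in>K. \<langle>g, v - x\<rangle> \<le> 0"
  \<comment> \<open>Testing with \<open>2 *\<^sub>R x\<close> leaves the increment \<open>x\<close>;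
    testing with \<open>0\<close> below leaves \<open>- x\<close>.\<close>
  have "2 *\<^sub>R x \<in> K" using assms(1) x by (rule mem_cone) simp
  then have "\<langle>g, x\<rangle> \<le> 0" using * by (force simp: scaleR_2)
  moreover have "\<langle>g, x\<rangle> \<ge> 0" using * assms(2) by (force simp: blinfun.minus_right)
  ultimately have "\<langle>g, x\<rangle> = 0" by simp
  with * show "g \<in> polar_cone K \<and> \<langle>g, x\<rangle> = 0"
    by (simp add: polar_cone_def blinfun.diff_right)
qed (simp add: polar_cone_def blinfun.diff_right)

theorem proposition3p13:
  fixes Vp :: "'v::{banach, lattice} set"
    and A :: "'v \<Rightarrow> 'v dual"
    and Ca Cb :: real
    and \<Phi> \<Phi>' :: "'v \<Rightarrow> 'v"
    and f d :: "'v dual"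
    and y \<alpha> :: 'v
  defines "K \<equiv> critical_cone A \<Phi> f y"
  assumes "reflexive_space TYPE('v)"
    and "closed Vp" and "convex Vp" and "cone Vp" and "Vp \<inter> uminus ` Vp = {0}"
    and "\<And>u v :: 'v. u \<le> v \<longleftrightarrow> v - u \<in> Vp"
    and "\<And>(x :: nat \<Rightarrow> 'v) l. x \<longlonglongrightarrow> l \<Longrightarrow> weakly_tendsto (\<lambda>n. sup 0 (x n)) (sup 0 l)"
    and "linear A"
    and "Ca > 0" and "Cb > 0"
    and "\<And>u v. \<langle>A u, v\<rangle> \<le> Cb * norm u * norm v"
    and "\<And>u. \<langle>A u, u\<rangle> \<ge> Ca * (norm u)\<^sup>2"
    and "\<And>u. \<langle>A (pos_part u), neg_part u\<rangle> \<le> 0"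
    and "y \<in> qvi_solutions A \<Phi> f"
    and "\<And>h. has_hadamard_dderiv \<Phi> y h (\<Phi>' h)"
  shows "(\<alpha> \<in> (+) (\<Phi>' \<alpha>) ` K \<and> (\<forall>v\<in>(+) (\<Phi>' \<alpha>) ` K. \<langle>A \<alpha> - d, \<alpha> - v\<rangle> \<le> 0))
    \<longleftrightarrow> (\<alpha> - \<Phi>' \<alpha> \<in> K \<and> d - A \<alpha> \<in> polar_cone K \<and> \<langle>d - A \<alpha>, \<Phi>' \<alpha> - \<alpha>\<rangle> = 0)"
proof -
  let ?x = "\<alpha> - \<Phi>' \<alpha>"
  have "y \<in> constraint_set \<Phi> y"
    using \<open>y \<in> qvi_solutions A \<Phi> f\<close> by (simp add: qvi_solutions_def)
  then have K: "cone K" "0 \<in> K"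
    unfolding K_def by (simp_all add: cone_critical_cone zero_in_critical_cone)
  have mem: "\<alpha> \<in> (+) (\<Phi>' \<alpha>) ` K \<longleftrightarrow> ?x \<in> K"
    by (metis add_diff_cancel_left' diff_add_cancel add.commute image_iff)
  \<comment> \<open>Both arguments of the pairing change sign, so the direction of the inequality is
    preserved.\<close>
  have "\<langle>A \<alpha> - d, \<alpha> - (\<Phi>' \<alpha> + v)\<rangle> = \<langle>d - A \<alpha>, v - ?x\<rangle>" for v
    by (simp add: blinfun.diff_left blinfun.diff_right blinfun.add_right)
  then have vi: "(\<forall>v\<in>(+) (\<Phi>' \<alpha>) ` K. \<langle>A \<alpha> - d, \<alpha> - v\<rangle> \<le> 0) \<longleftrightarrow>
      (\<forall>v\<in>K. \<langle>d - A \<alpha>, v - ?x\<rangle> \<le> 0)"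
    by simp
  have "\<langle>d - A \<alpha>, \<Phi>' \<alpha> - \<alpha>\<rangle> = - \<langle>d - A \<alpha>, ?x\<rangle>"
    by (simp add: blinfun.diff_right)
  with mem vi variational_inequality_cone_iff[OF K, of ?x "d - A \<alpha>"]
  show ?thesis by auto
qed

end
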